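(* Let $B\subseteq A$ be a regular inclusion of $C^*$-algebras with the ideal intersection property. Let $N\subseteq \mathcal{N}(A,B)$ be a $*$-semigroup of normalizers with dense span in $A$ and suppose there is an $N$-invariant faithful conditional expectation $E\colon A\to B$. Let $J$ be a regular ideal of $A$. Then $B/(J\cap B)$ has the ideal intersection property in $A/J$.
   Context: Ideals are closed and two-sided. For $X \subseteq A$, $X^\perp = \{a\in A : ax = xa = 0 \text{ for all } x\in X\}$; an ideal $J$ of $A$ is regular if $J = J^{\perp\perp}$. An inclusion of $C^*$-algebras $B\subseteq A$ means that $B$ is a $C^*$-subalgebra of $A$ containing an approximate unit for $A$. A normalizer of $B$ is an element $n\in A$ with $nBn^*\subseteq B$ and $n^*Bn\subseteq B$; $\mathcal{N}(A,B)$ is the set of all normalizers. The inclusion is regular if $\mathcal{N}(A,B)$ has dense linear span in $A$. A conditional expectation $E\colon A\to B$ is $N$-invariant if $nE(a)n^* = E(nan^* )$ for all $a\in A$ and $n\in N$; it is faithful if $E(a^*a)=0$ implies $a=0$. $B$ has the ideal intersection property in $A$ if $I\cap B\neq\{0\}$ for every non-zero ideal $I$ of $A$. For an ideal $J$ of $A$, $B/(J\cap B)$ is regarded as a $C^*$-subalgebra of $A/J$ via $b+(J\cap B)\mapsto b+J$. *)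

theory Defs
  imports "HOL-Analysis.Analysis" "HOL-Algebra.QuotRing" "HOL-Algebra.Module"
begin

section \<open>C*-algebras\<close>

text \<open>
  A C*-algebra is a structure with an explicit carrier, so that the quotient \<open>A/J\<close>, whose elements
  are cosets, is an object of the same kind as \<open>A\<close>. The record extends the \<open>module\<close> record of
  \<open>HOL-Algebra\<close> (scalars in the complex numbers). Algebras need not be unital: the field \<open>one\<close>
  inherited from the \<open>ring\<close> record is never constrained or used.
\<close>

record 'a cstar = "(complex, 'a) module" +
  adj :: "'a \<Rightarrow> 'a"
  nrm :: "'a \<Rightarrow> real"

definition complex_ring :: "complex ring" where
  "complex_ring = \<lparr>carrier = UNIV, mult = (*), one = 1, zero = 0, add = (+)\<rparr>"

text \<open>The value outside the carrier is fixed because the locale \<open>Metric_space\<close> requires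
  non-negativity and symmetry there as well.\<close>

definition cdist :: "'a cstar \<Rightarrow> 'a \<Rightarrow> 'a \<Rightarrow> real" where
  "cdist A x y =
     (if x \<in> carrier A \<and> y \<in> carrier A then nrm A (x \<ominus>\<^bsub>A\<^esub> y) else 0)"

abbreviation ctop :: "'a cstar \<Rightarrow> 'a topology" where
  "ctop A \<equiv> Metric_space.mtopology (carrier A) (cdist A)"

locale cstar_algebra = Module.module complex_ring A for A :: "'a cstar" (structure) +
  assumes mult_closed: "\<lbrakk>x \<in> carrier A; y \<in> carrier A\<rbrakk> \<Longrightarrow> x \<otimes> y \<in> carrier A"
    and mult_assoc: "\<lbrakk>x \<in> carrier A; y \<in> carrier A; z \<in> carrier A\<rbrakk>
          \<Longrightarrow> (x \<otimes> y) \<otimes> z = x \<otimes> (y \<otimes> z)"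
    and mult_l_distr: "\<lbrakk>x \<in> carrier A; y \<in> carrier A; z \<in> carrier A\<rbrakk>
          \<Longrightarrow> (x \<oplus> y) \<otimes> z = x \<otimes> z \<oplus> y \<otimes> z"
    and mult_r_distr: "\<lbrakk>x \<in> carrier A; y \<in> carrier A; z \<in> carrier A\<rbrakk>
          \<Longrightarrow> z \<otimes> (x \<oplus> y) = z \<otimes> x \<oplus> z \<otimes> y"
    and smult_mult_l: "\<lbrakk>x \<in> carrier A; y \<in> carrier A\<rbrakk>
          \<Longrightarrow> (c \<odot> x) \<otimes> y = c \<odot> (x \<otimes> y)"
    and smult_mult_r: "\<lbrakk>x \<in> carrier A; y \<in> carrier A\<rbrakk>
          \<Longrightarrow> x \<otimes> (c \<odot> y) = c \<odot> (x \<otimes> y)"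
    and adj_closed: "x \<in> carrier A \<Longrightarrow> adj A x \<in> carrier A"
    and adj_adj: "x \<in> carrier A \<Longrightarrow> adj A (adj A x) = x"
    and adj_add: "\<lbrakk>x \<in> carrier A; y \<in> carrier A\<rbrakk>
          \<Longrightarrow> adj A (x \<oplus> y) = adj A x \<oplus> adj A y"
    and adj_smult: "x \<in> carrier A \<Longrightarrow> adj A (c \<odot> x) = cnj c \<odot> adj A x"
    and adj_mult: "\<lbrakk>x \<in> carrier A; y \<in> carrier A\<rbrakk>
          \<Longrightarrow> adj A (x \<otimes> y) = adj A y \<otimes> adj A x"
    and nrm_nonneg: "x \<in> carrier A \<Longrightarrow> 0 \<le> nrm A x"
    and nrm_eq_0_iff: "x \<in> carrier A \<Longrightarrow> nrm A x = 0 \<longleftrightarrow> x = \<zero>"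
    and nrm_triangle: "\<lbrakk>x \<in> carrier A; y \<in> carrier A\<rbrakk>
          \<Longrightarrow> nrm A (x \<oplus> y) \<le> nrm A x + nrm A y"
    and nrm_smult: "x \<in> carrier A \<Longrightarrow> nrm A (c \<odot> x) = cmod c * nrm A x"
    and nrm_mult: "\<lbrakk>x \<in> carrier A; y \<in> carrier A\<rbrakk>
          \<Longrightarrow> nrm A (x \<otimes> y) \<le> nrm A x * nrm A y"
    and cstar_identity: "x \<in> carrier A \<Longrightarrow> nrm A (adj A x \<otimes> x) = (nrm A x)\<^sup>2"
    and complete: "Metric_space.mcomplete (carrier A) (cdist A)"

definition cspan :: "'a cstar \<Rightarrow> 'a set \<Rightarrow> 'a set" where
  "cspan A S = (\<lambda>V. submodule V complex_ring A) hull S"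

definition dense_span :: "'a cstar \<Rightarrow> 'a set \<Rightarrow> bool" where
  "dense_span A S \<longleftrightarrow> ctop A closure_of (cspan A S) = carrier A"

definition positive_element :: "'a cstar \<Rightarrow> 'a \<Rightarrow> bool" where
  "positive_element A x \<longleftrightarrow> (\<exists>y\<in>carrier A. x = adj A y \<otimes>\<^bsub>A\<^esub> y)"


section \<open>Ideals, annihilators, quotients\<close>

definition cstar_ideal :: "'a cstar \<Rightarrow> 'a set \<Rightarrow> bool" where
  "cstar_ideal A J \<longleftrightarrow> submodule J complex_ring A \<and> closedin (ctop A) J \<and>
     (\<forall>a\<in>carrier A. \<forall>x\<in>J. a \<otimes>\<^bsub>A\<^esub> x \<in> J \<and> x \<otimes>\<^bsub>A\<^esub> a \<in> J)"

definition annihilator :: "'a cstar \<Rightarrow> 'a set \<Rightarrow> 'a set" where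
  "annihilator A X =
     {a \<in> carrier A. \<forall>x\<in>X. a \<otimes>\<^bsub>A\<^esub> x = \<zero>\<^bsub>A\<^esub> \<and> x \<otimes>\<^bsub>A\<^esub> a = \<zero>\<^bsub>A\<^esub>}"

definition regular_ideal :: "'a cstar \<Rightarrow> 'a set \<Rightarrow> bool" where
  "regular_ideal A J \<longleftrightarrow> cstar_ideal A J \<and> J = annihilator A (annihilator A J)"

text \<open>
  The ring operations on cosets are those of the library's quotient ring; \<open>c (a + J) = c a + J\<close>,
  \<open>(a + J)* = a* + J\<close>, and the norm is the quotient norm.
\<close>

definition cstar_quotient :: "'a cstar \<Rightarrow> 'a set \<Rightarrow> 'a set cstar" where
  "cstar_quotient A J =
     \<lparr>carrier = carrier (A Quot J), mult = mult (A Quot J), one = one (A Quot J),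
      zero = zero (A Quot J), add = add (A Quot J),
      smult = (\<lambda>c X. \<Union>x\<in>X. J +>\<^bsub>A\<^esub> (c \<odot>\<^bsub>A\<^esub> x)),
      adj = (\<lambda>X. \<Union>x\<in>X. J +>\<^bsub>A\<^esub> adj A x),
      nrm = (\<lambda>X. Inf (nrm A ` X))\<rparr>"


section \<open>Inclusions\<close>

definition cstar_subalgebra :: "'a cstar \<Rightarrow> 'a set \<Rightarrow> bool" where
  "cstar_subalgebra A B \<longleftrightarrow> submodule B complex_ring A \<and> closedin (ctop A) B \<and>
     (\<forall>x\<in>B. \<forall>y\<in>B. x \<otimes>\<^bsub>A\<^esub> y \<in> B) \<and> (\<forall>x\<in>B. adj A x \<in> B)"

text \<open>
  The net is represented by the filter it generates on the algebra; this allows arbitrary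
  directed index sets without quantifying over types.
\<close>

definition contains_approximate_unit :: "'a cstar \<Rightarrow> 'a set \<Rightarrow> bool" where
  "contains_approximate_unit A B \<longleftrightarrow>
     (\<exists>F :: 'a filter. F \<noteq> bot \<and>
        (\<forall>\<^sub>F e in F. e \<in> B \<and> positive_element A e \<and> nrm A e \<le> 1) \<and>
        (\<forall>a\<in>carrier A. ((\<lambda>e. nrm A (e \<otimes>\<^bsub>A\<^esub> a \<ominus>\<^bsub>A\<^esub> a)) \<longlongrightarrow> 0) F \<and>
                         ((\<lambda>e. nrm A (a \<otimes>\<^bsub>A\<^esub> e \<ominus>\<^bsub>A\<^esub> a)) \<longlongrightarrow> 0) F))"

definition cstar_inclusion :: "'a cstar \<Rightarrow> 'a set \<Rightarrow> bool" where
  "cstar_inclusion A B \<longleftrightarrow>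
     cstar_algebra A \<and> cstar_subalgebra A B \<and> contains_approximate_unit A B"

definition normalizers :: "'a cstar \<Rightarrow> 'a set \<Rightarrow> 'a set" where
  "normalizers A B =
     {n \<in> carrier A. \<forall>b\<in>B. n \<otimes>\<^bsub>A\<^esub> b \<otimes>\<^bsub>A\<^esub> adj A n \<in> B \<and>
                            adj A n \<otimes>\<^bsub>A\<^esub> b \<otimes>\<^bsub>A\<^esub> n \<in> B}"

definition regular_inclusion :: "'a cstar \<Rightarrow> 'a set \<Rightarrow> bool" where
  "regular_inclusion A B \<longleftrightarrow> cstar_inclusion A B \<and> dense_span A (normalizers A B)"

definition star_semigroup :: "'a cstar \<Rightarrow> 'a set \<Rightarrow> bool" where
  "star_semigroup A N \<longleftrightarrow> N \<subseteq> carrier A \<and>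
     (\<forall>m\<in>N. \<forall>n\<in>N. m \<otimes>\<^bsub>A\<^esub> n \<in> N) \<and> (\<forall>n\<in>N. adj A n \<in> N)"

text \<open>
  Complete positivity is not listed separately: by the bimodule property,
  \<open>\<Sum>\<^sub>i\<^sub>j b\<^sub>i* E(a\<^sub>i* a\<^sub>j) b\<^sub>j = E(c* c)\<close> with \<open>c = \<Sum>\<^sub>i a\<^sub>i b\<^sub>i\<close>, so it follows from positivity.
\<close>

definition conditional_expectation :: "'a cstar \<Rightarrow> 'a set \<Rightarrow> ('a \<Rightarrow> 'a) \<Rightarrow> bool" where
  "conditional_expectation A B E \<longleftrightarrow>
     E \<in> carrier A \<rightarrow> B \<and>
     (\<forall>x\<in>carrier A. \<forall>y\<in>carrier A. E (x \<oplus>\<^bsub>A\<^esub> y) = E x \<oplus>\<^bsub>A\<^esub> E y) \<and>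
     (\<forall>c. \<forall>x\<in>carrier A. E (c \<odot>\<^bsub>A\<^esub> x) = c \<odot>\<^bsub>A\<^esub> E x) \<and>
     (\<forall>b\<in>B. E b = b) \<and>
     (\<forall>x\<in>carrier A. nrm A (E x) \<le> nrm A x) \<and>
     (\<forall>x\<in>carrier A. positive_element A x \<longrightarrow> positive_element A (E x)) \<and>
     (\<forall>x\<in>carrier A. \<forall>b\<in>B. E (b \<otimes>\<^bsub>A\<^esub> x) = b \<otimes>\<^bsub>A\<^esub> E x \<and>
                             E (x \<otimes>\<^bsub>A\<^esub> b) = E x \<otimes>\<^bsub>A\<^esub> b)"

definition faithful_expectation :: "'a cstar \<Rightarrow> ('a \<Rightarrow> 'a) \<Rightarrow> bool" where
  "faithful_expectation A E \<longleftrightarrow>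
     (\<forall>a\<in>carrier A. E (adj A a \<otimes>\<^bsub>A\<^esub> a) = \<zero>\<^bsub>A\<^esub> \<longrightarrow> a = \<zero>\<^bsub>A\<^esub>)"

definition invariant_expectation :: "'a cstar \<Rightarrow> 'a set \<Rightarrow> ('a \<Rightarrow> 'a) \<Rightarrow> bool" where
  "invariant_expectation A N E \<longleftrightarrow>
     (\<forall>a\<in>carrier A. \<forall>n\<in>N.
        n \<otimes>\<^bsub>A\<^esub> E a \<otimes>\<^bsub>A\<^esub> adj A n = E (n \<otimes>\<^bsub>A\<^esub> a \<otimes>\<^bsub>A\<^esub> adj A n))"

definition ideal_intersection_property :: "'a cstar \<Rightarrow> 'a set \<Rightarrow> bool" where
  "ideal_intersection_property A B \<longleftrightarrow>
     (\<forall>I. cstar_ideal A I \<and> I \<noteq> {\<zero>\<^bsub>A\<^esub>} \<longrightarrow> I \<inter> B \<noteq> {\<zero>\<^bsub>A\<^esub>})"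

text \<open>
  The image of \<open>B/(J \<inter> B)\<close> in \<open>A/J\<close> under \<open>b + (J \<inter> B) \<mapsto> b + J\<close>; \<open>A\<lparr>carrier := B\<rparr>\<close> is \<open>B\<close> with the
  operations and norm of \<open>A\<close>.
\<close>

definition quotient_embedding :: "'a cstar \<Rightarrow> 'a set \<Rightarrow> 'a set \<Rightarrow> 'a set" where
  "quotient_embedding A J X = (\<Union>b\<in>X. J +>\<^bsub>A\<^esub> b)"

definition quotient_subalgebra :: "'a cstar \<Rightarrow> 'a set \<Rightarrow> 'a set \<Rightarrow> 'a set set" where
  "quotient_subalgebra A B J =
     quotient_embedding A J ` carrier (cstar_quotient (A\<lparr>carrier := B\<rparr>) (J \<inter> B))"

end

theory Submission
  imports Defs
begin

text \<open>
  An ideal of \<open>A/J\<close> is \<open>K/J\<close> for a closed ideal \<open>K\<close> of \<open>A\<close>, and if it meets \<open>B/(J \<inter> B)\<close> trivially then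
  \<open>K \<inter> B \<subseteq> J\<close>. Hence the ideal \<open>K \<inter> J\<^sup>\<bottom>\<close> of \<open>A\<close> meets \<open>B\<close> inside \<open>J \<inter> J\<^sup>\<bottom> = 0\<close>, so it vanishes by the
  ideal intersection property of \<open>B\<close> in \<open>A\<close>. As \<open>K J\<^sup>\<bottom>\<close> and \<open>J\<^sup>\<bottom> K\<close> lie in it, \<open>K \<subseteq> J\<^sup>\<bottom>\<^sup>\<bottom> = J\<close>.
\<close>

text \<open>Each point outside \<open>C\<close> has a ball missing \<open>C\<close>; its radius is a
  lower bound for the distance to \<open>C\<close>. In this form closedness, in the algebra and in
  its quotient alike, becomes a norm estimate.\<close>

lemma (in Metric_space) closedin_mtopology_iff:
  "closedin mtopology C \<longleftrightarrow> C \<subseteq> M \<and> (\<forall>x\<in>M - C. \<exists>r>0. \<forall>y\<in>C. r \<le> d x y)"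
  unfolding closedin_metric disjnt_iff in_mball
  by (auto simp: not_less Ball_def) (metis subsetD not_less)+

section \<open>Zero, negatives and differences in a C*-algebra\<close>

context cstar_algebra
begin

lemma mult_zero_left: "x \<in> carrier A \<Longrightarrow> \<zero> \<otimes> x = \<zero>"
  using mult_l_distr[of \<zero> \<zero> x] mult_closed[of \<zero> x] by (metis add.r_cancel_one' zero_closed l_zero)

lemma mult_zero_right: "x \<in> carrier A \<Longrightarrow> x \<otimes> \<zero> = \<zero>"
  using mult_r_distr[of \<zero> \<zero> x] mult_closed[of x \<zero>] by (metis add.r_cancel_one' zero_closed l_zero)

lemma mult_minus_left:
  assumes "x \<in> carrier A" "y \<in> carrier A"
  shows "(\<ominus> x) \<otimes> y = \<ominus> (x \<otimes> y)"
proof -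
  have "(\<ominus> x) \<otimes> y \<oplus> x \<otimes> y = \<zero>"
    using assms mult_l_distr[of "\<ominus> x" x y] by (simp add: l_neg mult_zero_left)
  then show ?thesis using assms mult_closed by (simp add: minus_equality)
qed

lemma mult_minus_right:
  assumes "x \<in> carrier A" "y \<in> carrier A"
  shows "x \<otimes> (\<ominus> y) = \<ominus> (x \<otimes> y)"
proof -
  have "x \<otimes> (\<ominus> y) \<oplus> x \<otimes> y = \<zero>"
    using assms mult_r_distr[of "\<ominus> y" y x] by (simp add: l_neg mult_zero_right)
  then show ?thesis using assms mult_closed by (simp add: minus_equality)
qed

lemma carrier_complex_ring [simp]: "c \<in> carrier complex_ring"
  by (simp add: complex_ring_def)

text \<open>Links negation to scalars: homogeneity of the norm then makes the metric symmetric, and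
  closure under scalars gives closure under negation.\<close>

lemma smult_minus_one:
  assumes "x \<in> carrier A"
  shows "(-1) \<odot> x = \<ominus> x"
proof -
  have "(-1) \<odot> x \<oplus> x = \<zero>"
    using smult_l_distr[of "-1" 1 x] smult_l_null[of x] smult_one[of x] assms
    by (simp add: complex_ring_def)
  then show ?thesis using assms smult_closed[of "-1" x] by (simp add: minus_equality)
qed

lemma nrm_minus: "x \<in> carrier A \<Longrightarrow> nrm A (\<ominus> x) = nrm A x"
  using nrm_smult[of x "-1"] by (simp add: smult_minus_one)

lemma diff_diff_add:
  assumes "x \<in> carrier A" "y \<in> carrier A" "z \<in> carrier A"
  shows "x \<ominus> z = (x \<ominus> y) \<oplus> (y \<ominus> z)"
proof -
  have "(x \<ominus> y) \<oplus> (y \<ominus> z) = x \<oplus> ((\<ominus> y \<oplus> y) \<oplus> \<ominus> z)"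
    using assms by (simp add: a_minus_def a_assoc del: l_neg r_neg)
  then show ?thesis using assms by (simp add: l_neg a_minus_def)
qed

lemma minus_diff:
  assumes "x \<in> carrier A" "y \<in> carrier A"
  shows "\<ominus> (x \<ominus> y) = y \<ominus> x"
  using assms by (simp add: a_minus_def minus_add a_comm)

lemma diff_eq_zero_iff:
  assumes "x \<in> carrier A" "y \<in> carrier A"
  shows "x \<ominus> y = \<zero> \<longleftrightarrow> x = y"
proof
  assume "x \<ominus> y = \<zero>"
  then show "x = y" using assms minus_equality[of x "\<ominus> y"] by (simp add: a_minus_def)
qed (use assms in \<open>simp add: a_minus_def r_neg\<close>)

section \<open>The norm metric and its closed sets\<close>

lemma Metric_space_cdist: "Metric_space (carrier A) (cdist A)"
proof
  fix x y
  show "0 \<le> cdist A x y" by (simp add: cdist_def nrm_nonneg)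
  show "cdist A x y = cdist A y x"
  proof (cases "x \<in> carrier A \<and> y \<in> carrier A")
    case True
    then show ?thesis using nrm_minus[of "x \<ominus> y"] by (simp add: cdist_def minus_diff)
  qed (auto simp: cdist_def)
next
  fix x y assume "x \<in> carrier A" "y \<in> carrier A"
  then show "cdist A x y = 0 \<longleftrightarrow> x = y"
    by (simp add: cdist_def nrm_eq_0_iff diff_eq_zero_iff)
next
  fix x y z assume "x \<in> carrier A" "y \<in> carrier A" "z \<in> carrier A"
  then show "cdist A x z \<le> cdist A x y + cdist A y z"
    using nrm_triangle[of "x \<ominus> y" "y \<ominus> z"] by (simp add: cdist_def diff_diff_add[of x y z])
qed

lemma closedin_ctop:
  "closedin (ctop A) C \<longleftrightarrow> C \<subseteq> carrier A \<and>
     (\<forall>x\<in>carrier A - C. \<exists>r>0. \<forall>y\<in>C. r \<le> nrm A (x \<ominus> y))"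
  unfolding Metric_space.closedin_mtopology_iff[OF Metric_space_cdist]
  by (rule conj_cong[OF refl]) (auto simp: cdist_def subset_iff)

section \<open>Closed two-sided ideals and annihilators\<close>

lemma complex_submoduleD:
  assumes "submodule H complex_ring A"
  shows "H \<subseteq> carrier A" "\<zero> \<in> H" "\<And>x. x \<in> H \<Longrightarrow> \<ominus> x \<in> H"
    "\<And>x y. \<lbrakk>x \<in> H; y \<in> H\<rbrakk> \<Longrightarrow> x \<oplus> y \<in> H" "\<And>c x. x \<in> H \<Longrightarrow> c \<odot> x \<in> H"
  using submoduleE[OF assms] subgroup.one_closed[OF submodule.axioms(1)[OF assms]] by auto

text \<open>Containment in the carrier is part of closedness, and closure under negation is
  multiplication by the scalar \<open>-1\<close>.\<close>

lemma cstar_idealI: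
  assumes "closedin (ctop A) H" "\<zero> \<in> H"
    and "\<And>x y. \<lbrakk>x \<in> H; y \<in> H\<rbrakk> \<Longrightarrow> x \<oplus> y \<in> H" "\<And>c x. x \<in> H \<Longrightarrow> c \<odot> x \<in> H"
    and "\<And>a x. \<lbrakk>a \<in> carrier A; x \<in> H\<rbrakk> \<Longrightarrow> a \<otimes> x \<in> H"
    and "\<And>a x. \<lbrakk>a \<in> carrier A; x \<in> H\<rbrakk> \<Longrightarrow> x \<otimes> a \<in> H"
  shows "cstar_ideal A H"
proof -
  have sub: "H \<subseteq> carrier A" using assms(1) by (simp add: closedin_ctop)
  have "submodule H complex_ring A"
  proof (rule submoduleI)
    fix a assume "a \<in> H"
    then show "\<ominus> a \<in> H" using assms(4)[of a "-1"] smult_minus_one sub by auto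
  qed (use assms sub in auto)
  then show ?thesis using assms by (auto simp: cstar_ideal_def)
qed

lemma cstar_ideal_Int:
  assumes "cstar_ideal A H" "cstar_ideal A K"
  shows "cstar_ideal A (H \<inter> K)"
  using assms complex_submoduleD[of H] complex_submoduleD[of K] unfolding cstar_ideal_def
  by (intro cstar_idealI[unfolded cstar_ideal_def]) auto

text \<open>Multiplication by a fixed \<open>x\<close> is Lipschitz with constant
  \<open>nrm A x\<close>. If \<open>y\<close> annihilates \<open>x\<close>, then \<open>a\<close>
  and \<open>a \<ominus> y\<close> have the same products with \<open>x\<close>, so a nonzero
  product keeps \<open>y\<close> away from \<open>a\<close>.\<close>

lemma closedin_annihilator:
  assumes "X \<subseteq> carrier A"
  shows "closedin (ctop A) (annihilator A X)"
  unfolding closedin_ctop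
proof (intro conjI ballI)
  show "annihilator A X \<subseteq> carrier A" by (auto simp: annihilator_def)
next
  fix a assume a: "a \<in> carrier A - annihilator A X"
  then obtain x where x: "x \<in> X" "a \<otimes> x \<noteq> \<zero> \<or> x \<otimes> a \<noteq> \<zero>"
    by (auto simp: annihilator_def)
  \<comment> \<open>The maximum treats both sides at once: it is positive as soon as one of the two
    products is nonzero.\<close>
  define m where "m = max (nrm A (a \<otimes> x)) (nrm A (x \<otimes> a))"
  have xc: "x \<in> carrier A" and ac: "a \<in> carrier A" using assms x a by auto
  have "nrm A (a \<otimes> x) \<noteq> 0 \<or> nrm A (x \<otimes> a) \<noteq> 0"
    using x xc ac mult_closed by (simp add: nrm_eq_0_iff)
  then have m: "m > 0"
    using nrm_nonneg mult_closed xc ac unfolding m_def by (metis less_max_iff_disj order_le_imp_less_or_eq)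
  have nx: "nrm A x \<ge> 0" using nrm_nonneg xc by simp
  \<comment> \<open>The \<open>+ 1\<close> makes the denominator positive without an argument that
    \<open>x\<close> is nonzero.\<close>
  have "m / (nrm A x + 1) \<le> nrm A (a \<ominus> y)" if y: "y \<in> annihilator A X" for y
  proof -
    have yc: "y \<in> carrier A" and y0: "y \<otimes> x = \<zero>" "x \<otimes> y = \<zero>"
      using y x by (auto simp: annihilator_def)
    have "(a \<ominus> y) \<otimes> x = a \<otimes> x" "x \<otimes> (a \<ominus> y) = x \<otimes> a"
      using xc ac yc y0 mult_closed
      by (simp_all add: a_minus_def mult_l_distr mult_r_distr mult_minus_left mult_minus_right)
    then have "m \<le> nrm A (a \<ominus> y) * nrm A x"
      using nrm_mult[of "a \<ominus> y" x] nrm_mult[of x "a \<ominus> y"] xc ac yc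
      by (simp add: m_def mult.commute)
    also have "\<dots> \<le> nrm A (a \<ominus> y) * (nrm A x + 1)"
      using nrm_nonneg[of "a \<ominus> y"] ac yc by (intro mult_left_mono) auto
    finally show ?thesis using nx by (simp add: divide_le_eq)
  qed
  then show "\<exists>r>0. \<forall>y\<in>annihilator A X. r \<le> nrm A (a \<ominus> y)"
    using m nx by (intro exI[of _ "m / (nrm A x + 1)"]) auto
qed

text \<open>Absorption rests on \<open>J\<close> being two-sided: in
  \<open>y \<otimes> (a \<otimes> x)\<close> with \<open>y \<in> J\<close>, reassociating puts
  \<open>y \<otimes> a\<close> into \<open>J\<close>, where \<open>x\<close> kills it; the other
  side is symmetric.\<close>

lemma cstar_ideal_annihilator:
  assumes J: "cstar_ideal A J"
  shows "cstar_ideal A (annihilator A J)"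
proof -
  have sub: "\<And>x. x \<in> J \<Longrightarrow> x \<in> carrier A"
    and l: "\<And>a x. \<lbrakk>a \<in> carrier A; x \<in> J\<rbrakk> \<Longrightarrow> a \<otimes> x \<in> J"
    and r: "\<And>a x. \<lbrakk>a \<in> carrier A; x \<in> J\<rbrakk> \<Longrightarrow> x \<otimes> a \<in> J"
    using J complex_submoduleD(1)[of J] by (auto simp: cstar_ideal_def)
  show ?thesis
  proof (rule cstar_idealI)
    show "closedin (ctop A) (annihilator A J)" using sub by (intro closedin_annihilator) auto
  next
    fix a x assume a: "a \<in> carrier A" and "x \<in> annihilator A J"
    then have x: "x \<in> carrier A" "\<And>y. y \<in> J \<Longrightarrow> x \<otimes> y = \<zero>" "\<And>y. y \<in> J \<Longrightarrow> y \<otimes> x = \<zero>"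
      by (auto simp: annihilator_def)
    show "a \<otimes> x \<in> annihilator A J"
      using a x sub r by (auto simp: annihilator_def mult_closed mult_assoc mult_zero_right
          simp flip: mult_assoc[of _ a x])
    show "x \<otimes> a \<in> annihilator A J"
      using a x sub l by (auto simp: annihilator_def mult_closed mult_assoc mult_zero_left
          simp flip: mult_assoc[of _ x a])
  qed (auto simp: annihilator_def sub mult_zero_left mult_zero_right mult_l_distr mult_r_distr
      smult_mult_l smult_mult_r)
qed

text \<open>For \<open>x\<close> in both sets, \<open>y = adj A x \<otimes> x\<close> lies in
  \<open>J\<close>, so \<open>x \<otimes> y\<close> vanishes and hence so does
  \<open>y \<otimes> y\<close>. As \<open>y\<close> is self-adjoint, the C*-identity gives first
  \<open>y = \<zero>\<close> and then \<open>x = \<zero>\<close>.\<close>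

lemma ideal_Int_annihilator:
  assumes J: "cstar_ideal A J"
  shows "J \<inter> annihilator A J \<subseteq> {\<zero>}"
proof
  fix x assume x: "x \<in> J \<inter> annihilator A J"
  then have xc: "x \<in> carrier A" by (auto simp: annihilator_def)
  define y where "y = adj A x \<otimes> x"
  have yJ: "y \<in> J" using J x xc by (auto simp: cstar_ideal_def y_def adj_closed)
  have yc: "y \<in> carrier A" using xc by (simp add: y_def adj_closed mult_closed)
  have ya: "adj A y = y" using xc by (simp add: y_def adj_mult adj_closed adj_adj)
  have "x \<otimes> y = \<zero>" using x yJ by (auto simp: annihilator_def)
  then have "y \<otimes> y = \<zero>"
    using xc yc mult_assoc[of "adj A x" x y] by (simp add: y_def[symmetric] adj_closed mult_zero_right)
  then have "(nrm A y)\<^sup>2 = 0" using cstar_identity[OF yc] ya nrm_eq_0_iff[of \<zero>] by simp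
  then have "(nrm A x)\<^sup>2 = 0" using cstar_identity[OF xc] y_def by simp
  then show "x \<in> {\<zero>}" using nrm_eq_0_iff[OF xc] by simp
qed

end

section \<open>Arithmetic of cosets modulo a closed ideal\<close>

locale cstar_quotient_algebra = cstar_algebra +
  fixes J
  assumes ideal: "cstar_ideal A J"
begin

abbreviation Q where "Q \<equiv> cstar_quotient A J"

text \<open>Provides the theory of additive cosets for \<open>J\<close>. Since the algebra may lack
  a unit, only its additive group is used here; products of cosets are computed separately.\<close>

sublocale abelian_subgroup J A
  using ideal M.abelian_group_axioms
  by (auto simp: cstar_ideal_def intro!: abelian_subgroupI3 additive_subgroup.intro submodule.axioms(1))

lemma J_carrier: "x \<in> J \<Longrightarrow> x \<in> carrier A"
  using a_Hcarr .

lemma J_mult: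
  assumes "a \<in> carrier A" "x \<in> J"
  shows "a \<otimes> x \<in> J" "x \<otimes> a \<in> J"
  using ideal assms by (auto simp: cstar_ideal_def)

lemma J_smult: "x \<in> J \<Longrightarrow> c \<odot> x \<in> J"
  using ideal complex_submoduleD(5) by (auto simp: cstar_ideal_def)

lemma mem_coset: "y \<in> J +> x \<longleftrightarrow> (\<exists>j\<in>J. y = j \<oplus> x)"
  by (auto simp: a_r_coset_def')

lemma coset_eq_iff:
  assumes "x \<in> carrier A" "y \<in> carrier A"
  shows "J +> x = J +> y \<longleftrightarrow> x \<ominus> y \<in> J"
proof
  assume "J +> x = J +> y"
  then obtain j where "j \<in> J" "x = j \<oplus> y" using a_rcos_self[OF assms(1)] by (auto simp: mem_coset)
  moreover then have "x \<ominus> y = j" using assms J_carrier by (simp add: a_minus_def a_assoc r_neg)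
  ultimately show "x \<ominus> y \<in> J" by simp
next
  assume "x \<ominus> y \<in> J"
  moreover have "x = (x \<ominus> y) \<oplus> y" using assms by (simp add: a_minus_def a_assoc l_neg)
  ultimately have "x \<in> J +> y" by (auto simp: mem_coset)
  then show "J +> x = J +> y" using a_repr_independence' assms a_subgroup by metis
qed

lemma coset_add_left:
  assumes "j \<in> J" "x \<in> carrier A"
  shows "J +> (j \<oplus> x) = J +> x"
  using assms J_carrier by (simp add: coset_eq_iff a_minus_def a_assoc r_neg)

lemma coset_eq_J_iff: "x \<in> carrier A \<Longrightarrow> J +> x = J \<longleftrightarrow> x \<in> J"
  using coset_eq_iff[of x \<zero>] a_subset minus_equality[of \<zero> \<zero>] by (simp add: a_minus_def)

lemma
  shows carrier_quotient: "carrier Q = (\<lambda>x. J +> x) ` carrier A"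
    and zero_quotient: "\<zero>\<^bsub>Q\<^esub> = J"
    and nrm_quotient: "nrm Q X = Inf (nrm A ` X)"
  by (auto simp: cstar_quotient_def FactRing_def A_RCOSETS_def')

lemma add_quotient:
  "\<lbrakk>x \<in> carrier A; y \<in> carrier A\<rbrakk> \<Longrightarrow> (J +> x) \<oplus>\<^bsub>Q\<^esub> (J +> y) = J +> (x \<oplus> y)"
  by (simp add: cstar_quotient_def FactRing_def a_rcos_sum)

text \<open>The product of cosets is a union over all pairs of representatives, so every member of
  that union has to be the same coset. With \<open>u = i \<oplus> x\<close> and
  \<open>v = j \<oplus> y\<close>, the products \<open>u \<otimes> v\<close> and
  \<open>x \<otimes> y\<close> differ by \<open>i \<otimes> v \<oplus> x \<otimes> j\<close>, which
  lies in \<open>J\<close>.\<close>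

lemma mult_quotient:
  assumes x: "x \<in> carrier A" and y: "y \<in> carrier A"
  shows "(J +> x) \<otimes>\<^bsub>Q\<^esub> (J +> y) = J +> (x \<otimes> y)"
proof -
  have "J +> (u \<otimes> v) = J +> (x \<otimes> y)" if "u \<in> J +> x" "v \<in> J +> y" for u v
  proof -
    obtain i j where i: "i \<in> J" "u = i \<oplus> x" and j: "j \<in> J" "v = j \<oplus> y"
      using \<open>u \<in> J +> x\<close> \<open>v \<in> J +> y\<close> by (auto simp: mem_coset)
    have "u \<otimes> v = (i \<otimes> v \<oplus> x \<otimes> j) \<oplus> x \<otimes> y"
      using i j x y J_carrier by (simp add: mult_l_distr mult_r_distr mult_closed a_ac)
    moreover have "i \<otimes> v \<oplus> x \<otimes> j \<in> J"
      using i j x y J_carrier J_mult by (intro a_closed) auto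
    ultimately show ?thesis
      using x y mult_closed by (simp add: coset_add_left)
  qed
  then have "(\<Union>u\<in>J +> x. \<Union>v\<in>J +> y. J +> (u \<otimes> v)) = J +> (x \<otimes> y)"
    using a_rcos_self[OF x] a_rcos_self[OF y] by blast
  then show ?thesis by (simp add: cstar_quotient_def FactRing_def rcoset_mult_def)
qed

lemma smult_quotient:
  assumes x: "x \<in> carrier A"
  shows "c \<odot>\<^bsub>Q\<^esub> (J +> x) = J +> (c \<odot> x)"
proof -
  have "J +> (c \<odot> y) = J +> (c \<odot> x)" if y: "y \<in> J +> x" for y
  proof -
    obtain j where j: "j \<in> J" "y = j \<oplus> x" using y by (auto simp: mem_coset)
    have "c \<odot> y = c \<odot> j \<oplus> c \<odot> x" using j x J_carrier smult_r_distr by simp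
    then show ?thesis using j x J_smult by (simp add: coset_add_left)
  qed
  then have "(\<Union>y\<in>J +> x. J +> (c \<odot> y)) = J +> (c \<odot> x)"
    using a_rcos_self[OF x] by blast
  then show ?thesis by (simp add: cstar_quotient_def)
qed

text \<open>An additive inverse depends only on carrier, addition and zero. \<open>Q\<close> shares
  these with the additive quotient group \<open>A_Mod J\<close>, where the inverse of a coset is
  known.\<close>

lemma minus_quotient:
  assumes x: "x \<in> carrier A" and y: "y \<in> carrier A"
  shows "(J +> x) \<ominus>\<^bsub>Q\<^esub> (J +> y) = J +> (x \<ominus> y)"
proof -
  have "\<ominus>\<^bsub>Q\<^esub> (J +> y) = inv\<^bsub>A A_Mod J\<^esub> (J +> y)"
    by (simp add: a_inv_def m_inv_def cstar_quotient_def FactRing_def A_FactGroup_def')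
  also have "\<dots> = J +> (\<ominus> y)"
    using y a_inv_FactGroup[of "J +> y"] a_rcos_inv[OF y]
    by (auto simp: A_FactGroup_def' A_RCOSETS_def')
  finally have "\<ominus>\<^bsub>Q\<^esub> (J +> y) = J +> (\<ominus> y)" .
  then show ?thesis using x y by (simp add: a_minus_def add_quotient)
qed

section \<open>The quotient norm and its metric\<close>

lemma nrm_quotient_le:
  assumes "x \<in> carrier A"
  shows "nrm Q (J +> x) \<le> nrm A x"
  unfolding nrm_quotient
proof (rule cInf_lower)
  show "nrm A x \<in> nrm A ` (J +> x)" using a_rcos_self[OF assms] by blast
  show "bdd_below (nrm A ` (J +> x))"
    using assms J_carrier nrm_nonneg by (intro bdd_belowI[of _ 0]) (auto simp: mem_coset)
qed

text \<open>Supplies a representative that nearly attains the infimum. Definiteness, the triangle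
  inequality and symmetry pass from \<open>A\<close> to \<open>Q\<close> through such
  representatives.\<close>

lemma nrm_quotient_lift:
  assumes x: "x \<in> carrier A" and e: "e > 0"
  obtains u where "u \<in> carrier A" "J +> u = J +> x" "nrm A u < nrm Q (J +> x) + e"
proof -
  have "Inf (nrm A ` (J +> x)) < nrm Q (J +> x) + e" using e by (simp add: nrm_quotient)
  then obtain u where "u \<in> J +> x" "nrm A u < nrm Q (J +> x) + e"
    using cInf_lessD[of "nrm A ` (J +> x)"] a_rcos_self[OF x] by blast
  then show ?thesis using that[of u] x J_carrier coset_add_left by (auto simp: mem_coset)
qed

lemma nrm_quotient_nonneg:
  assumes "x \<in> carrier A"
  shows "0 \<le> nrm Q (J +> x)"
  unfolding nrm_quotient using a_rcos_self[OF assms] assms J_carrier nrm_nonneg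
  by (intro cInf_greatest) (blast, auto simp: mem_coset)

text \<open>Closedness of \<open>J\<close> enters here: a point \<open>x\<close> outside
  \<open>J\<close> has some distance \<open>r > 0\<close> from \<open>J\<close>, whereas norm zero
  would give a representative \<open>u\<close> of norm below \<open>r\<close>, and then
  \<open>x \<ominus> u\<close> is a point of \<open>J\<close> too close to \<open>x\<close>.\<close>

lemma nrm_quotient_eq_0_iff:
  assumes x: "x \<in> carrier A"
  shows "nrm Q (J +> x) = 0 \<longleftrightarrow> x \<in> J"
proof
  assume 0: "nrm Q (J +> x) = 0"
  show "x \<in> J"
  proof (rule ccontr)
    assume "x \<notin> J"
    then obtain r where r: "r > 0" "\<And>y. y \<in> J \<Longrightarrow> r \<le> nrm A (x \<ominus> y)"
      using ideal x unfolding cstar_ideal_def closedin_ctop by blast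
    obtain u where u: "u \<in> carrier A" "J +> u = J +> x" "nrm A u < r"
      using nrm_quotient_lift[OF x \<open>r > 0\<close>] 0 by auto
    have "x \<ominus> u \<in> J" using u x by (simp flip: coset_eq_iff)
    moreover have "x \<ominus> (x \<ominus> u) = u"
      using x u by (simp add: a_minus_def minus_add r_neg flip: a_assoc)
    ultimately show False using r(2)[of "x \<ominus> u"] u(3) by simp
  qed
next
  assume "x \<in> J"
  then have "J +> x = J +> \<zero>" using x coset_add_left[of x \<zero>] by simp
  then show "nrm Q (J +> x) = 0"
    using nrm_quotient_le[of \<zero>] nrm_quotient_nonneg[OF x] nrm_eq_0_iff[of \<zero>] by simp
qed

lemma nrm_quotient_triangle:
  assumes x: "x \<in> carrier A" and y: "y \<in> carrier A"
  shows "nrm Q (J +> (x \<oplus> y)) \<le> nrm Q (J +> x) + nrm Q (J +> y)"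
proof (rule field_le_epsilon)
  fix e :: real assume "e > 0"
  then have e2: "e / 2 > 0" by simp
  obtain u where u: "u \<in> carrier A" "J +> u = J +> x" "nrm A u < nrm Q (J +> x) + e / 2"
    by (rule nrm_quotient_lift[OF x e2])
  obtain v where v: "v \<in> carrier A" "J +> v = J +> y" "nrm A v < nrm Q (J +> y) + e / 2"
    by (rule nrm_quotient_lift[OF y e2])
  have "J +> (x \<oplus> y) = J +> (u \<oplus> v)" using x y u v by (simp flip: add_quotient)
  then have "nrm Q (J +> (x \<oplus> y)) \<le> nrm A (u \<oplus> v)" using u v nrm_quotient_le by simp
  then show "nrm Q (J +> (x \<oplus> y)) \<le> nrm Q (J +> x) + nrm Q (J +> y) + e"
    using nrm_triangle[OF u(1) v(1)] u(3) v(3) by simp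
qed

text \<open>Half of the symmetry of the metric; exchanging \<open>x\<close> and \<open>y\<close>
  gives the other half. The negative of a near-optimal representative of one class represents the
  other and has the same norm.\<close>

lemma nrm_quotient_diff_le:
  assumes x: "x \<in> carrier A" and y: "y \<in> carrier A"
  shows "nrm Q (J +> (x \<ominus> y)) \<le> nrm Q (J +> (y \<ominus> x))"
proof (rule field_le_epsilon)
  fix e :: real assume "e > 0"
  then obtain u where u: "u \<in> carrier A" "J +> u = J +> (y \<ominus> x)"
      "nrm A u < nrm Q (J +> (y \<ominus> x)) + e"
    using nrm_quotient_lift[of "y \<ominus> x"] x y by auto
  have "J +> (x \<ominus> y) = J +> ((-1) \<odot> (y \<ominus> x))" using x y by (simp add: smult_minus_one minus_diff)
  also have "\<dots> = J +> (\<ominus> u)" using x y u by (simp flip: smult_quotient smult_minus_one)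
  finally have "nrm Q (J +> (x \<ominus> y)) \<le> nrm A u"
    using nrm_quotient_le[of "\<ominus> u"] u(1) by (simp add: nrm_minus)
  then show "nrm Q (J +> (x \<ominus> y)) \<le> nrm Q (J +> (y \<ominus> x)) + e" using u(3) by simp
qed

lemma cdist_quotient:
  "\<lbrakk>x \<in> carrier A; y \<in> carrier A\<rbrakk> \<Longrightarrow> cdist Q (J +> x) (J +> y) = nrm Q (J +> (x \<ominus> y))"
  by (simp add: cdist_def carrier_quotient minus_quotient)

text \<open>Closedness in \<open>ctop Q\<close> can be turned into distance estimates only once
  \<open>cdist Q\<close> is known to be a metric.\<close>

lemma Metric_space_cdist_quotient: "Metric_space (carrier Q) (cdist Q)"
proof
  fix X Y
  have *: "0 \<le> cdist Q X Y \<and> cdist Q X Y = cdist Q Y X" if "X \<in> carrier Q" "Y \<in> carrier Q"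
    using that nrm_quotient_nonneg
    by (auto simp: carrier_quotient cdist_quotient intro!: antisym nrm_quotient_diff_le)
  then show "0 \<le> cdist Q X Y" "cdist Q X Y = cdist Q Y X" by (auto simp: cdist_def)
next
  fix X Y assume "X \<in> carrier Q" "Y \<in> carrier Q"
  then show "cdist Q X Y = 0 \<longleftrightarrow> X = Y"
    by (auto simp: carrier_quotient cdist_quotient nrm_quotient_eq_0_iff simp flip: coset_eq_iff)
next
  fix X Y Z assume "X \<in> carrier Q" "Y \<in> carrier Q" "Z \<in> carrier Q"
  then obtain x y z where xyz: "x \<in> carrier A" "y \<in> carrier A" "z \<in> carrier A"
    and "X = J +> x" "Y = J +> y" "Z = J +> z" by (auto simp: carrier_quotient)
  then show "cdist Q X Z \<le> cdist Q X Y + cdist Q Y Z"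
    using nrm_quotient_triangle[of "x \<ominus> y" "y \<ominus> z"]
    by (simp add: cdist_quotient diff_diff_add[of x y z])
qed

section \<open>Pulling ideals back from the quotient, and the image of \<open>B\<close> in
  it\<close>

lemma cstar_ideal_preimage:
  assumes I: "cstar_ideal Q I"
  shows "cstar_ideal A {x \<in> carrier A. J +> x \<in> I}"
proof (rule cstar_idealI)
  have sub: "submodule I complex_ring Q" and clo: "closedin (ctop Q) I"
    and abs: "\<And>a x. \<lbrakk>a \<in> carrier Q; x \<in> I\<rbrakk> \<Longrightarrow> a \<otimes>\<^bsub>Q\<^esub> x \<in> I \<and> x \<otimes>\<^bsub>Q\<^esub> a \<in> I"
    using I by (auto simp: cstar_ideal_def)
  have sg: "subgroup I (add_monoid Q)" using sub by (rule submodule.axioms(1))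
  let ?K = "{x \<in> carrier A. J +> x \<in> I}"
  show "\<zero> \<in> ?K"
    using subgroup.one_closed[OF sg] a_subset coset_eq_J_iff[of \<zero>] by (simp add: zero_quotient)
  show "x \<oplus> y \<in> ?K" if "x \<in> ?K" "y \<in> ?K" for x y
    using that subgroup.m_closed[OF sg, of "J +> x" "J +> y"] by (simp add: add_quotient)
  show "c \<odot> x \<in> ?K" if "x \<in> ?K" for c x
    using that submodule.smult_closed[OF sub, of c "J +> x"] by (simp add: smult_quotient)
  show "a \<otimes> x \<in> ?K" "x \<otimes> a \<in> ?K" if "a \<in> carrier A" "x \<in> ?K" for a x
    using that abs[of "J +> a" "J +> x"] by (auto simp: carrier_quotient mult_quotient mult_closed)
  show "closedin (ctop A) ?K"
    unfolding closedin_ctop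
  proof (intro conjI ballI)
    fix x assume x: "x \<in> carrier A - ?K"
    then have "J +> x \<in> carrier Q - I" by (auto simp: carrier_quotient)
    then obtain r where r: "r > 0" "\<And>Y. Y \<in> I \<Longrightarrow> r \<le> cdist Q (J +> x) Y"
      using clo
      unfolding Metric_space.closedin_mtopology_iff[OF Metric_space_cdist_quotient] by blast
    have "r \<le> nrm A (x \<ominus> y)" if y: "y \<in> ?K" for y
    proof -
      \<comment> \<open>The quotient map is contractive, so a bound for the distance from
        \<open>J +> x\<close> to \<open>I\<close> also bounds the distance from \<open>x\<close> to
        the preimage.\<close>
      have "r \<le> nrm Q (J +> (x \<ominus> y))"
        using r(2)[of "J +> y"] x y by (simp add: cdist_quotient)
      also have "\<dots> \<le> nrm A (x \<ominus> y)" using x y nrm_quotient_le by simp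
      finally show ?thesis .
    qed
    then show "\<exists>r>0. \<forall>y\<in>?K. r \<le> nrm A (x \<ominus> y)" using r(1) by blast
  qed auto
qed

lemma coset_in_quotient_subalgebra:
  assumes B: "submodule B complex_ring A" and b: "b \<in> B"
  shows "J +> b \<in> quotient_subalgebra A B J"
proof -
  have Bc: "B \<subseteq> carrier A" "\<zero> \<in> B" using complex_submoduleD[OF B] by auto
  \<comment> \<open>This is the coset of \<open>b\<close> modulo \<open>J \<inter> B\<close> formed
    inside \<open>B\<close>, hence an element of \<open>B/(J \<inter> B)\<close>.\<close>
  let ?X = "{j \<oplus> b | j. j \<in> J \<inter> B}"
  have "?X \<in> carrier (cstar_quotient (A\<lparr>carrier := B\<rparr>) (J \<inter> B))"
    using b by (auto simp: cstar_quotient_def FactRing_def A_RCOSETS_def' a_r_coset_def')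
  moreover have "quotient_embedding A J ?X = J +> b"
  proof -
    have "J +> x = J +> b" if "x \<in> ?X" for x using that b Bc by (auto simp: coset_add_left)
    \<comment> \<open>All sets in the union defining the embedding equal \<open>J +> b\<close>; the
      member \<open>b\<close> ensures that the union is not empty.\<close>
    moreover have "b \<in> ?X" using b Bc a_subset by (auto intro!: exI[of _ \<zero>])
    ultimately show ?thesis unfolding quotient_embedding_def by blast
  qed
  ultimately show ?thesis unfolding quotient_subalgebra_def by (metis (no_types, lifting) imageI)
qed

end

section \<open>Transfer of the ideal intersection property to the quotient\<close>

theorem theorem4p2:
  fixes A :: "'a cstar" and B N J :: "'a set" and E :: "'a \<Rightarrow> 'a"
  assumes "regular_inclusion A B"
    and "ideal_intersection_property A B"
    and "N \<subseteq> normalizers A B"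
    and "star_semigroup A N"
    and "dense_span A N"
    and "conditional_expectation A B E"
    and "invariant_expectation A N E"
    and "faithful_expectation A E"
    and "regular_ideal A J"
  shows "ideal_intersection_property (cstar_quotient A J) (quotient_subalgebra A B J)"
proof -
  have "cstar_algebra A" and B: "submodule B complex_ring A"
    using assms(1) by (auto simp: regular_inclusion_def cstar_inclusion_def cstar_subalgebra_def)
  moreover have J: "cstar_ideal A J" and reg: "J = annihilator A (annihilator A J)"
    using assms(9) by (auto simp: regular_ideal_def)
  ultimately interpret cstar_quotient_algebra A J
    by (intro cstar_quotient_algebra.intro cstar_quotient_algebra_axioms.intro)
  show ?thesis
    unfolding ideal_intersection_property_def zero_quotient
  proof (intro allI impI notI)
    fix I assume I: "cstar_ideal Q I \<and> I \<noteq> {J}" and meet: "I \<inter> quotient_subalgebra A B J = {J}"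
    define K where "K = {x \<in> carrier A. J +>\<^bsub>A\<^esub> x \<in> I}"
    let ?L = "K \<inter> annihilator A J"
    have K: "cstar_ideal A K" using I cstar_ideal_preimage by (simp add: K_def)
    have L: "cstar_ideal A ?L" using K J by (intro cstar_ideal_Int cstar_ideal_annihilator)
    have "K \<inter> B \<subseteq> J"
    proof
      fix b assume "b \<in> K \<inter> B"
      \<comment> \<open>The coset of \<open>b\<close> lies in \<open>I\<close> and in the image of
        \<open>B\<close>, so by \<open>meet\<close> it is \<open>J\<close>, the zero of the
        quotient.\<close>
      then have "b \<in> carrier A" "J +>\<^bsub>A\<^esub> b \<in> I \<inter> quotient_subalgebra A B J"
        using coset_in_quotient_subalgebra[OF B] by (auto simp: K_def)
      then show "b \<in> J" using meet coset_eq_J_iff by auto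
    qed
    then have "?L \<inter> B \<subseteq> {\<zero>\<^bsub>A\<^esub>}" using ideal_Int_annihilator[OF J] by blast
    \<comment> \<open>The intersection property compares with the set \<open>{\<zero>}\<close>
      exactly, so the inclusion just shown is completed to an equality.\<close>
    moreover have "\<zero>\<^bsub>A\<^esub> \<in> ?L \<inter> B"
      using L complex_submoduleD(2)[OF B] complex_submoduleD(2)[of ?L] by (auto simp: cstar_ideal_def)
    ultimately have L0: "?L = {\<zero>\<^bsub>A\<^esub>}"
      using assms(2) L unfolding ideal_intersection_property_def by blast
    have "K \<subseteq> annihilator A (annihilator A J)"
    proof
      fix k assume k: "k \<in> K"
      have kc: "k \<in> carrier A" using k by (simp add: K_def)
      \<comment> \<open>Both \<open>K\<close> and the annihilator absorb products, so these lie in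
        the intersection, which \<open>L0\<close> says is zero.\<close>
      have "k \<otimes>\<^bsub>A\<^esub> x \<in> ?L \<and> x \<otimes>\<^bsub>A\<^esub> k \<in> ?L" if x: "x \<in> annihilator A J" for x
      proof -
        have xc: "x \<in> carrier A" using x by (simp add: annihilator_def)
        show ?thesis
          using K cstar_ideal_annihilator[OF J] k kc x xc by (simp add: cstar_ideal_def)
      qed
      then show "k \<in> annihilator A (annihilator A J)" using kc L0 by (auto simp: annihilator_def)
    qed
    then have KJ: "K \<subseteq> J" using reg by simp
    have "X = J" if X: "X \<in> I" for X
    proof -
      have "X \<in> carrier Q" using I X Metric_space.closedin_mtopology_iff[OF Metric_space_cdist_quotient]
        by (auto simp: cstar_ideal_def)
      then obtain x where "x \<in> carrier A" "X = J +>\<^bsub>A\<^esub> x" by (auto simp: carrier_quotient)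
      then show ?thesis using X KJ coset_eq_J_iff by (auto simp: K_def)
    qed
    \<comment> \<open>\<open>meet\<close> also puts \<open>J\<close> into \<open>I\<close>, so
      \<open>I\<close> is exactly \<open>{J}\<close>, the zero ideal excluded at the start.\<close>
    then show False using I meet by blast
  qed
qed

end
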